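(* The relaxation (SCoP) is equivalent to the relaxation (DSCoP).
   Context: Data: points $(\mathsf x^i,y^i)\in\mathbb R^n\times\{-1,1\}$ for $i=1,\dots,m$, a constant $C>0$, and a nonnegative integer $B$ (the feature budget). Inequalities between vectors are componentwise; $\mathsf e$ and $\mathsf o$ denote the all-ones and all-zeros vectors; $\mathcal S_+^k$ is the set of real symmetric positive-semidefinite $k\times k$ matrices; $\operatorname{diag}\mathsf X=[X_{jj}]_{j=1}^n$ is the vector of diagonal entries of $\mathsf X$. Two minimization problems are called equivalent if they have the same optimal value. Define $$\Xi=\{(\mathsf w,b,\bm\xi)\in\mathbb R^n\times\mathbb R\times\mathbb R^m:\ y^i(\mathsf w^\top \mathsf x^i+b)\ge 1-\xi_i\ (i=1,\dots,m),\ \bm\xi\ge \mathsf o\}.$$ (SCoP): minimize $\frac12\operatorname{trace}(\mathsf W)+C\sum_{i=1}^m\xi_i$ over $(\mathsf w,\mathsf W,b,\bm\xi,\mathsf R,\mathsf u,\mathsf U)$, with $\mathsf u\in\mathbb R^n$ and $\mathsf W,\mathsf R,\mathsf U$ real $n\times n$ matrices, subject to $(\mathsf w,b,\bm\xi)\in\Xi$, $\mathsf e^\top\mathsf u=n-B$, $\operatorname{diag}\mathsf R=\mathsf o$, $\operatorname{diag}\mathsf U=\mathsf u$, $$\begin{bmatrix}1&\mathsf w^\top&\mathsf u^\top\\ \mathsf w&\mathsf W&\mathsf R\\ \mathsf u&\mathsf R^\top&\mathsf U\end{bmatrix}\in\mathcal S_+^{2n+1}.$$ (DSCoP): minimize $\frac12\sum_{j=1}^n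 W_{jj}+C\sum_{i=1}^m\xi_i$ over $(\mathsf w,\operatorname{diag}\mathsf W,b,\bm\xi,\mathsf u)$ (where only the $n$ real numbers $W_{11},\dots,W_{nn}$ are variables in place of a matrix $\mathsf W$, and $\mathsf u\in\mathbb R^n$) subject to $(\mathsf w,b,\bm\xi)\in\Xi$, $\mathsf e^\top\mathsf u=n-B$, $$\begin{bmatrix}1&w_j&u_j\\ w_j&W_{jj}&0\\ u_j&0&u_j\end{bmatrix}\in\mathcal S_+^3,\qquad j=1,\dots,n.$$ *)

theory Defs
  imports "HOL-Analysis.Analysis"
begin

definition optimal_value :: "'a set \<Rightarrow> ('a \<Rightarrow> real) \<Rightarrow> ereal" where
  "optimal_value S f = (INF z\<in>S. ereal (f z))"  (* \<infinity> for an infeasible problem *)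

definition equivalent_problems ::
  "'a set \<Rightarrow> ('a \<Rightarrow> real) \<Rightarrow> 'b set \<Rightarrow> ('b \<Rightarrow> real) \<Rightarrow> bool" where
  "equivalent_problems S f T g \<longleftrightarrow> optimal_value S f = optimal_value T g"

definition psd_matrices :: "(real^'k^'k) set" where
  "psd_matrices = {A. transpose A = A \<and> (\<forall>v. 0 \<le> v \<bullet> (A *v v))}"

definition diag_vec :: "real^'n^'n \<Rightarrow> real^'n" where
  "diag_vec A = (\<chi> j. A $ j $ j)"

definition Xi :: "('m \<Rightarrow> real^'n) \<Rightarrow> ('m \<Rightarrow> real) \<Rightarrow> ((real^'n) \<times> real \<times> (real^'m)) set" where
  "Xi x y = {(w, b, \<xi>). (\<forall>i. y i * (w \<bullet> x i + b) \<ge> 1 - \<xi> $ i) \<and> (\<forall>i. \<xi> $ i \<ge> 0)}"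

(* The index type of size 2n+1 is unit + 'n + 'n, one summand for each block. *)
fun scop_entry :: "real^'n \<Rightarrow> real^'n^'n \<Rightarrow> real^'n^'n \<Rightarrow> real^'n \<Rightarrow> real^'n^'n
    \<Rightarrow> unit + 'n + 'n \<Rightarrow> unit + 'n + 'n \<Rightarrow> real" where
  "scop_entry w W R u U (Inl _)       (Inl _)       = 1"
| "scop_entry w W R u U (Inl _)       (Inr (Inl j)) = w $ j"
| "scop_entry w W R u U (Inl _)       (Inr (Inr j)) = u $ j"
| "scop_entry w W R u U (Inr (Inl i)) (Inl _)       = w $ i"
| "scop_entry w W R u U (Inr (Inl i)) (Inr (Inl j)) = W $ i $ j"
| "scop_entry w W R u U (Inr (Inl i)) (Inr (Inr j)) = R $ i $ j"
| "scop_entry w W R u U (Inr (Inr i)) (Inl _)       = u $ i"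
| "scop_entry w W R u U (Inr (Inr i)) (Inr (Inl j)) = transpose R $ i $ j"
| "scop_entry w W R u U (Inr (Inr i)) (Inr (Inr j)) = U $ i $ j"

definition scop_matrix :: "real^'n \<Rightarrow> real^'n^'n \<Rightarrow> real^'n^'n \<Rightarrow> real^'n \<Rightarrow> real^'n^'n
    \<Rightarrow> real^(unit + 'n + 'n)^(unit + 'n + 'n)" where
  "scop_matrix w W R u U = (\<chi> p q. scop_entry w W R u U p q)"

definition scop_feasible :: "('m \<Rightarrow> real^'n) \<Rightarrow> ('m \<Rightarrow> real) \<Rightarrow> nat \<Rightarrow>
    ((real^'n) \<times> (real^'n^'n) \<times> real \<times> (real^'m) \<times> (real^'n^'n) \<times> (real^'n) \<times> (real^'n^'n)) set" where
  "scop_feasible x y B = {(w, W, b, \<xi>, R, u, U).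
     (w, b, \<xi>) \<in> Xi x y \<and>
     (\<Sum>j\<in>UNIV. u $ j) = real CARD('n) - real B \<and>
     diag_vec R = 0 \<and>
     diag_vec U = u \<and>
     scop_matrix w W R u U \<in> psd_matrices}"

definition scop_objective :: "real \<Rightarrow>
    (real^'n) \<times> (real^'n^'n) \<times> real \<times> (real^'m) \<times> (real^'n^'n) \<times> (real^'n) \<times> (real^'n^'n) \<Rightarrow> real" where
  "scop_objective C = (\<lambda>(w, W, b, \<xi>, R, u, U). 1/2 * trace W + C * (\<Sum>i\<in>UNIV. \<xi> $ i))"

definition dscop_matrix :: "real \<Rightarrow> real \<Rightarrow> real \<Rightarrow> real^3^3" where
  "dscop_matrix wj Wjj uj = vector
     [vector [1,  wj,  uj],
      vector [wj, Wjj, 0 ],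
      vector [uj, 0,   uj]]"

(* The component d stands for diag W. *)
definition dscop_feasible :: "('m \<Rightarrow> real^'n) \<Rightarrow> ('m \<Rightarrow> real) \<Rightarrow> nat \<Rightarrow>
    ((real^'n) \<times> (real^'n) \<times> real \<times> (real^'m) \<times> (real^'n)) set" where
  "dscop_feasible x y B = {(w, d, b, \<xi>, u).
     (w, b, \<xi>) \<in> Xi x y \<and>
     (\<Sum>j\<in>UNIV. u $ j) = real CARD('n) - real B \<and>
     (\<forall>j. dscop_matrix (w $ j) (d $ j) (u $ j) \<in> psd_matrices)}"

definition dscop_objective :: "real \<Rightarrow>
    (real^'n) \<times> (real^'n) \<times> real \<times> (real^'m) \<times> (real^'n) \<Rightarrow> real" where
  "dscop_objective C = (\<lambda>(w, d, b, \<xi>, u). 1/2 * (\<Sum>j\<in>UNIV. d $ j) + C * (\<Sum>i\<in>UNIV. \<xi> $ i))"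

end

theory Submission
  imports Defs
begin

text \<open>
  Both relaxations have the same attainable objective values, because feasible points can be
  transported in either direction without changing the objective.

  From (SCoP) to (DSCoP) one keeps the diagonal of \<open>W\<close>: for each \<open>j\<close> the small matrix is the
  principal submatrix of the large one on the border index and the two indices belonging to \<open>j\<close>,
  its entries \<open>0\<close> and \<open>u $ j\<close> being the prescribed diagonals of \<open>R\<close> and \<open>U\<close>.

  The converse is a positive-semidefinite completion problem.  The specified entries of the large
  matrix are those of the \<open>n\<close> small matrices, which overlap only in the border entry \<open>1\<close>.
  Eliminating this entry from the \<open>j\<close>-th small matrix leaves the Schur complement
  \<open>[[d\<^sub>j - w\<^sub>j\<^sup>2, - w\<^sub>j u\<^sub>j], [- w\<^sub>j u\<^sub>j, u\<^sub>j - u\<^sub>j\<^sup>2]]\<close>, which is positive semidefinite.  The completion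
  is the rank-one matrix generated by \<open>(1, w, u)\<close> plus the direct sum of these complements, so that
  \<open>W = w w\<^sup>T + Diag (d - w\<^sup>2)\<close>, \<open>R = w u\<^sup>T - Diag (w u)\<close> and \<open>U = u u\<^sup>T + Diag (u - u\<^sup>2)\<close>.
  All of this is carried out on quadratic forms (\<open>dscop_matrix_psd_iff\<close> and
  \<open>scop_matrix_psd_iff\<close>); the two directions are \<open>dscop_psd_of_scop_psd\<close> and
  \<open>scop_completion_psd\<close>.
\<close>

lemma equivalent_problemsI:
  assumes "\<And>z. z \<in> S \<Longrightarrow> \<exists>z'\<in>T. g z' \<le> f z"
    and "\<And>z'. z' \<in> T \<Longrightarrow> \<exists>z\<in>S. f z \<le> g z'"
  shows "equivalent_problems S f T g"
  unfolding equivalent_problems_def optimal_value_def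
proof (rule INF_eq)
  show "\<exists>z\<in>S. ereal (f z) \<le> ereal (g z')" if "z' \<in> T" for z'
    using assms(2)[OF that] by simp
  show "\<exists>z'\<in>T. ereal (g z') \<le> ereal (f z)" if "z \<in> S" for z
    using assms(1)[OF that] by simp
qed

lemma dscop_matrix_psd_iff:
  "dscop_matrix a d c \<in> psd_matrices \<longleftrightarrow>
    (\<forall>t p q. 0 \<le> t\<^sup>2 + 2 * a * t * p + 2 * c * t * q + d * p\<^sup>2 + c * q\<^sup>2)"
proof -
  have sym: "transpose (dscop_matrix a d c) = dscop_matrix a d c"
    by (simp add: vec_eq_iff transpose_def dscop_matrix_def forall_3)
  have form: "v \<bullet> (dscop_matrix a d c *v v) =
      (v $ 1)\<^sup>2 + 2 * a * v $ 1 * v $ 2 + 2 * c * v $ 1 * v $ 3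
        + d * (v $ 2)\<^sup>2 + c * (v $ 3)\<^sup>2" for v
    by (simp add: inner_vec_def matrix_vector_mult_def dscop_matrix_def sum_3
        power2_eq_square algebra_simps)
  have "(\<forall>v. 0 \<le> v \<bullet> (dscop_matrix a d c *v v)) \<longleftrightarrow>
      (\<forall>t p q. 0 \<le> t\<^sup>2 + 2 * a * t * p + 2 * c * t * q + d * p\<^sup>2 + c * q\<^sup>2)"
    unfolding form by (simp add: forall_vector_3)
  then show ?thesis
    by (simp add: psd_matrices_def sym)
qed

lemma scop_matrix_psd_iff:
  fixes w u :: "real^'n::finite"
  shows "scop_matrix w W R u U \<in> psd_matrices \<longleftrightarrow>
    transpose W = W \<and> transpose U = U \<and>
    (\<forall>t p q. 0 \<le> t\<^sup>2 + 2 * t * (w \<bullet> p) + 2 * t * (u \<bullet> q)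
        + p \<bullet> (W *v p) + 2 * (p \<bullet> (R *v q)) + q \<bullet> (U *v q))"
proof -
  have sym: "transpose (scop_matrix w W R u U) = scop_matrix w W R u U \<longleftrightarrow>
      transpose W = W \<and> transpose U = U"
    by (auto simp: vec_eq_iff transpose_def scop_matrix_def split_sum_all)
  have sum_blocks: "(\<Sum>k\<in>UNIV. f k) =
      f (Inl ()) + (\<Sum>j\<in>UNIV. f (Inr (Inl j))) + (\<Sum>j\<in>UNIV. f (Inr (Inr j)))"
    for f :: "unit + 'n + 'n \<Rightarrow> real"
    by (simp add: UNIV_Plus_UNIV[symmetric] sum.Plus UNIV_unit del: UNIV_Plus_UNIV)
  define p where "p v = (\<chi> j. v $ Inr (Inl j))" for v :: "real^(unit + 'n + 'n)"
  define q where "q v = (\<chi> j. v $ Inr (Inr j))" for v :: "real^(unit + 'n + 'n)"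
  have form: "v \<bullet> (scop_matrix w W R u U *v v) =
      (v $ Inl ())\<^sup>2 + 2 * v $ Inl () * (w \<bullet> p v) + 2 * v $ Inl () * (u \<bullet> q v)
        + p v \<bullet> (W *v p v) + 2 * (p v \<bullet> (R *v q v)) + q v \<bullet> (U *v q v)" for v
  proof -
    let ?z = "scop_matrix w W R u U *v v"
    have blocks: "?z $ Inl () = v $ Inl () + w \<bullet> p v + u \<bullet> q v"
      "p ?z = v $ Inl () *\<^sub>R w + W *v p v + R *v q v"
      "q ?z = v $ Inl () *\<^sub>R u + transpose R *v p v + U *v q v"
      by (simp_all add: vec_eq_iff inner_vec_def matrix_vector_mult_def scop_matrix_def
          sum_blocks p_def q_def mult_ac)
    have split: "v \<bullet> ?z = v $ Inl () * ?z $ Inl () + p v \<bullet> p ?z + q v \<bullet> q ?z"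
      by (simp add: inner_vec_def sum_blocks p_def q_def)
    have adjoint: "q v \<bullet> (transpose R *v p v) = p v \<bullet> (R *v q v)"
      by (metis dot_lmul_matrix inner_commute transpose_matrix_vector)
    show ?thesis
      unfolding split blocks inner_add_right inner_scaleR_right adjoint
      by (simp add: inner_commute power2_eq_square algebra_simps)
  qed
  have "(\<forall>v. 0 \<le> v \<bullet> (scop_matrix w W R u U *v v)) \<longleftrightarrow>
    (\<forall>t p q. 0 \<le> t\<^sup>2 + 2 * t * (w \<bullet> p) + 2 * t * (u \<bullet> q)
        + p \<bullet> (W *v p) + 2 * (p \<bullet> (R *v q)) + q \<bullet> (U *v q))"
    (is "?lhs \<longleftrightarrow> (\<forall>t p q. ?nonneg t p q)")
  proof (intro iffI allI)
    fix t p' q' assume ?lhs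
    define v :: "real^(unit + 'n + 'n)" where
      "v = (\<chi> k. case k of Inl _ \<Rightarrow> t | Inr (Inl j) \<Rightarrow> p' $ j | Inr (Inr j) \<Rightarrow> q' $ j)"
    have "v $ Inl () = t" "p v = p'" "q v = q'"
      by (simp_all add: v_def p_def q_def)
    with \<open>?lhs\<close> form[of v] show "?nonneg t p' q'"
      by metis
  qed (simp add: form)
  then show ?thesis
    by (simp add: psd_matrices_def sym)
qed

text \<open>Restricting the large quadratic form to vectors supported on the border index and the two
  indices of \<open>j\<close> passes to a principal submatrix.\<close>

lemma dscop_psd_of_scop_psd:
  fixes w u :: "real^'n::finite"
  assumes "scop_matrix w W R u U \<in> psd_matrices"
    and "diag_vec R = 0" and "diag_vec U = u"
  shows "dscop_matrix (w $ j) (diag_vec W $ j) (u $ j) \<in> psd_matrices"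
  unfolding dscop_matrix_psd_iff
proof (intro allI)
  fix t p q :: real
  have border: "z \<bullet> axis j r = r * z $ j" for z :: "real^'n" and r
    by (simp add: inner_axis)
  have column: "(A *v axis j s) $ j = s * A $ j $ j" for s and A :: "real^'n^'n"
    by (simp add: matrix_vector_mul_component border)
  have entry: "axis j r \<bullet> (A *v axis j s) = r * s * diag_vec A $ j"
    for r s and A :: "real^'n^'n"
    by (simp add: inner_axis' column diag_vec_def)
  have "0 \<le> t\<^sup>2 + 2 * t * (w \<bullet> axis j p) + 2 * t * (u \<bullet> axis j q)
      + axis j p \<bullet> (W *v axis j p) + 2 * (axis j p \<bullet> (R *v axis j q))
      + axis j q \<bullet> (U *v axis j q)"
    using assms(1) unfolding scop_matrix_psd_iff by blast
  then show "0 \<le> t\<^sup>2 + 2 * w $ j * t * p + 2 * u $ j * t * q + diag_vec W $ j * p\<^sup>2 + u $ j * q\<^sup>2"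
    unfolding entry border assms(2,3) by (simp add: power2_eq_square mult_ac)
qed

definition outer_plus_diag :: "real^'n \<Rightarrow> real^'n \<Rightarrow> real^'n \<Rightarrow> real^'n^'n" where
  "outer_plus_diag a b c = (\<chi> i j. a $ i * b $ j + (if i = j then c $ i else 0))"

lemma diag_vec_outer_plus_diag:
  "diag_vec (outer_plus_diag a b c) = (\<chi> j. a $ j * b $ j + c $ j)"
  by (simp add: diag_vec_def outer_plus_diag_def)

lemma transpose_outer_plus_diag: "transpose (outer_plus_diag a a c) = outer_plus_diag a a c"
  by (simp add: vec_eq_iff transpose_def outer_plus_diag_def mult.commute)

lemma inner_outer_plus_diag:
  fixes a b c p q :: "real^'n::finite"
  shows "p \<bullet> (outer_plus_diag a b c *v q) =
    (a \<bullet> p) * (b \<bullet> q) + (\<Sum>j\<in>UNIV. c $ j * p $ j * q $ j)"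
proof -
  have "(\<Sum>j\<in>UNIV. (a $ i * b $ j + (if i = j then c $ i else 0)) * q $ j) =
      (\<Sum>j\<in>UNIV. a $ i * (b $ j * q $ j) + (if i = j then c $ j * q $ j else 0))" for i
    by (rule sum.cong) (auto simp: algebra_simps)
  then have "outer_plus_diag a b c *v q = (b \<bullet> q) *\<^sub>R a + (\<chi> j. c $ j * q $ j)"
    by (simp add: vec_eq_iff matrix_vector_mult_def outer_plus_diag_def inner_vec_def
        sum.distrib sum_distrib_left[symmetric] mult.commute)
  moreover have "p \<bullet> (\<chi> j. c $ j * q $ j) = (\<Sum>j\<in>UNIV. c $ j * p $ j * q $ j)"
    by (simp add: inner_vec_def mult_ac)
  ultimately show ?thesis
    by (simp add: inner_add_right inner_commute)
qed

text \<open>For this completion the large quadratic form is the square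
  \<open>(t + w \<bullet> p + u \<bullet> q)\<^sup>2\<close> of the rank-one part plus the sum of the Schur complements.  The Schur
  complement of the \<open>j\<close>-th small matrix is nonnegative because it is the minimum of the small
  quadratic form over its border variable, attained at \<open>- (w $ j * p $ j + u $ j * q $ j)\<close>.\<close>

lemma scop_completion_psd:
  fixes w d u :: "real^'n::finite"
  assumes "\<And>j. dscop_matrix (w $ j) (d $ j) (u $ j) \<in> psd_matrices"
  shows "scop_matrix w (outer_plus_diag w w (\<chi> j. d $ j - (w $ j)\<^sup>2))
    (outer_plus_diag w u (\<chi> j. - (w $ j * u $ j))) u
    (outer_plus_diag u u (\<chi> j. u $ j - (u $ j)\<^sup>2)) \<in> psd_matrices"
  unfolding scop_matrix_psd_iff
proof (intro conjI allI transpose_outer_plus_diag)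
  fix t :: real and p q :: "real^'n"
  let ?W = "outer_plus_diag w w (\<chi> j. d $ j - (w $ j)\<^sup>2)"
  let ?R = "outer_plus_diag w u (\<chi> j. - (w $ j * u $ j))"
  let ?U = "outer_plus_diag u u (\<chi> j. u $ j - (u $ j)\<^sup>2)"
  define s where "s j = (d $ j - (w $ j)\<^sup>2) * p $ j * p $ j
      + 2 * (- (w $ j * u $ j) * p $ j * q $ j) + (u $ j - (u $ j)\<^sup>2) * q $ j * q $ j" for j
  have "0 \<le> s j" for j
  proof -
    define r where "r = - (w $ j * p $ j + u $ j * q $ j)"
    have "0 \<le> r\<^sup>2 + 2 * w $ j * r * p $ j + 2 * u $ j * r * q $ j
        + d $ j * (p $ j)\<^sup>2 + u $ j * (q $ j)\<^sup>2"
      using assms[of j] unfolding dscop_matrix_psd_iff by blast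
    also have "\<dots> = s j"
      by (simp add: r_def s_def power2_eq_square algebra_simps)
    finally show ?thesis .
  qed
  then have "0 \<le> (t + w \<bullet> p + u \<bullet> q)\<^sup>2 + sum s UNIV"
    by (simp add: sum_nonneg)
  also have "\<dots> = t\<^sup>2 + 2 * t * (w \<bullet> p) + 2 * t * (u \<bullet> q)
      + p \<bullet> (?W *v p) + 2 * (p \<bullet> (?R *v q)) + q \<bullet> (?U *v q)"
    unfolding s_def inner_outer_plus_diag sum.distrib sum_distrib_left[symmetric]
    by (simp add: power2_eq_square algebra_simps)
  finally show "0 \<le> t\<^sup>2 + 2 * t * (w \<bullet> p) + 2 * t * (u \<bullet> q)
      + p \<bullet> (?W *v p) + 2 * (p \<bullet> (?R *v q)) + q \<bullet> (?U *v q)" .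
qed

lemma trace_eq_sum_diag_vec: "trace A = (\<Sum>j\<in>UNIV. diag_vec A $ j)"
  by (simp add: trace_def diag_vec_def)

theorem theorem3p6:
  fixes x :: "'m::finite \<Rightarrow> real^'n::finite"
    and y :: "'m \<Rightarrow> real"
    and C :: real
    and B :: nat
  assumes "\<And>i. y i \<in> {-1, 1}"
    and "C > 0"
  shows "equivalent_problems
           (scop_feasible x y B) (scop_objective C)
           (dscop_feasible x y B) (dscop_objective C)"
proof (rule equivalent_problemsI)
  fix z assume "z \<in> scop_feasible x y B"
  then obtain w W b \<xi> R u U where z: "z = (w, W, b, \<xi>, R, u, U)"
    and feas: "(w, b, \<xi>) \<in> Xi x y" "(\<Sum>j\<in>UNIV. u $ j) = real CARD('n) - real B"
      "diag_vec R = 0" "diag_vec U = u" "scop_matrix w W R u U \<in> psd_matrices"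
    by (auto simp: scop_feasible_def)
  have "(w, diag_vec W, b, \<xi>, u) \<in> dscop_feasible x y B"
    using feas(1,2) dscop_psd_of_scop_psd[OF feas(5,3,4)] by (simp add: dscop_feasible_def)
  moreover have "dscop_objective C (w, diag_vec W, b, \<xi>, u) = scop_objective C z"
    by (simp add: z dscop_objective_def scop_objective_def trace_eq_sum_diag_vec)
  ultimately show "\<exists>z'\<in>dscop_feasible x y B. dscop_objective C z' \<le> scop_objective C z"
    by (blast intro: eq_refl)
next
  fix z' assume "z' \<in> dscop_feasible x y B"
  then obtain w d b \<xi> u where z': "z' = (w, d, b, \<xi>, u)"
    and feas: "(w, b, \<xi>) \<in> Xi x y" "(\<Sum>j\<in>UNIV. u $ j) = real CARD('n) - real B"
      "\<And>j. dscop_matrix (w $ j) (d $ j) (u $ j) \<in> psd_matrices"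
    by (auto simp: dscop_feasible_def)
  let ?W = "outer_plus_diag w w (\<chi> j. d $ j - (w $ j)\<^sup>2)"
  let ?R = "outer_plus_diag w u (\<chi> j. - (w $ j * u $ j))"
  let ?U = "outer_plus_diag u u (\<chi> j. u $ j - (u $ j)\<^sup>2)"
  have diag: "diag_vec ?W = d" "diag_vec ?R = 0" "diag_vec ?U = u"
    by (simp_all add: diag_vec_outer_plus_diag vec_eq_iff power2_eq_square)
  have "(w, ?W, b, \<xi>, ?R, u, ?U) \<in> scop_feasible x y B"
    using feas(1,2) diag(2,3) scop_completion_psd[OF feas(3)] by (simp add: scop_feasible_def)
  moreover have "scop_objective C (w, ?W, b, \<xi>, ?R, u, ?U) = dscop_objective C z'"
    by (simp add: z' dscop_objective_def scop_objective_def trace_eq_sum_diag_vec diag(1))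
  ultimately show "\<exists>z\<in>scop_feasible x y B. scop_objective C z \<le> dscop_objective C z'"
    by (blast intro: eq_refl)
qed

end
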